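(* Let $\mathfrak{N}$ be a nest of closed subspaces of a Hilbert space $H$. Then there exists an operator $T$ in the nest algebra $\mathcal{T}(\mathfrak{N})$ such that $T$ is distributionally chaotic.
   Context: A nest $\mathfrak{N}$ is a chain (a set totally ordered by inclusion) of closed subspaces of a Hilbert space $H$ which contains $\{0\}$ and $H$ and is closed under intersection and closed span. The nest algebra $\mathcal{T}(\mathfrak{N})$ of a given nest $\mathfrak{N}$ is the set of all bounded linear operators $T$ on $H$ such that $TN\subseteq N$ for every $N\in\mathfrak{N}$. Distributional chaos: for a continuous map $f:X\to X$ on a metric space $(X,d)$ (for an operator on a Hilbert space, $d(x,y)=\|x-y\|$), a pair $x,y\in X$, $n\in\mathbb{N}$ with $n\ge 1$ and $\tau\in\mathbb{R}$, put $F^{n}_{xy}(\tau)=\frac1n\#\{0\le i\le n-1: d(f^i(x),f^i(y))<\tau\}$, $F_{xy}(\tau)=\liminf_{n\to\infty}F^n_{xy}(\tau)$ and $F^*_{xy}(\tau)=\limsup_{n\to\infty}F^n_{xy}(\tau)$. The pair $\{x,y\}$ is distributionally chaotic if $F^*_{xy}(\tau)=1$ for all $\tau>0$ and $F_{xy}(\epsilon)=0$ for some $\epsilon>0$. The map $f$ is distributionally chaotic if there is an uncountable subset $\Lambda\subseteq X$ such that every pair of two distinct points of $\Lambda$ is a distributionally chaotic pair.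
   Formalization: The Hilbert space H is assumed to be infinite-dimensional (and complex); on a finite-dimensional H, for instance H = {0}, no bounded linear operator is distributionally chaotic, so the statement fails there. *)

theory Defs
  imports "HOL-Analysis.Analysis"
begin

text \<open>
  A complex Hilbert space is rendered as a complete real inner product space together with a
  complex scalar multiplication extending the real one and a sesquilinear form whose real part
  is the real inner product.  Positive definiteness of \<open>cinner\<close> and the identity
  \<open>norm x = sqrt (Re (cinner x x))\<close> are then inherited from \<open>real_inner\<close>.
\<close>

class chilbert_space = real_inner + complete_space +
  fixes scaleC :: "complex \<Rightarrow> 'a \<Rightarrow> 'a"  (infixr \<open>*\<^sub>C\<close> 75)
    and cinner :: "'a \<Rightarrow> 'a \<Rightarrow> complex"
  assumes scaleC_add_right: "a *\<^sub>C (x + y) = a *\<^sub>C x + a *\<^sub>C y"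
    and scaleC_add_left: "(a + b) *\<^sub>C x = a *\<^sub>C x + b *\<^sub>C x"
    and scaleC_scaleC: "a *\<^sub>C (b *\<^sub>C x) = (a * b) *\<^sub>C x"
    and scaleC_of_real: "complex_of_real r *\<^sub>C x = r *\<^sub>R x"
    and cinner_commute: "cinner x y = cnj (cinner y x)"
    and cinner_add_left: "cinner (x + y) z = cinner x z + cinner y z"
    and cinner_scaleC_left: "cinner (a *\<^sub>C x) y = a * cinner x y"
    and Re_cinner: "Re (cinner x y) = inner x y"

instantiation complex :: chilbert_space
begin

definition scaleC_complex_def: "scaleC (a::complex) (x::complex) = a * x"
definition cinner_complex_def: "cinner (x::complex) y = x * cnj y"

instance
  by standard
    (simp_all add: scaleC_complex_def cinner_complex_def algebra_simps scaleR_conv_of_real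
      inner_complex_def)

end

global_interpretation complex_vector: vector_space "scaleC :: complex \<Rightarrow> 'a \<Rightarrow> 'a::chilbert_space"
  defines csubspace = complex_vector.subspace
    and cspan = complex_vector.span
proof
  fix a b :: complex and x y :: 'a
  show "a *\<^sub>C (x + y) = a *\<^sub>C x + a *\<^sub>C y" by (rule scaleC_add_right)
  show "(a + b) *\<^sub>C x = a *\<^sub>C x + b *\<^sub>C x" by (rule scaleC_add_left)
  show "a *\<^sub>C (b *\<^sub>C x) = (a * b) *\<^sub>C x" by (rule scaleC_scaleC)
  show "1 *\<^sub>C x = x" using scaleC_of_real[of 1 x] by simp
qed

definition finite_cdim :: "'a::chilbert_space itself \<Rightarrow> bool" where
  "finite_cdim _ \<longleftrightarrow> (\<exists>B :: 'a set. finite B \<and> cspan B = UNIV)"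

text \<open>
  For \<open>\<S> = {}\<close> the closure conditions yield \<open>UNIV\<close> and \<open>{0}\<close>, which belong to the nest anyway.
\<close>

definition nest :: "'a::chilbert_space set set \<Rightarrow> bool" where
  "nest \<N> \<longleftrightarrow>
     (\<forall>N\<in>\<N>. csubspace N \<and> closed N) \<and>
     (\<forall>M\<in>\<N>. \<forall>N\<in>\<N>. M \<subseteq> N \<or> N \<subseteq> M) \<and>
     {0} \<in> \<N> \<and> UNIV \<in> \<N> \<and>
     (\<forall>\<S>. \<S> \<subseteq> \<N> \<longrightarrow> \<Inter>\<S> \<in> \<N>) \<and>
     (\<forall>\<S>. \<S> \<subseteq> \<N> \<longrightarrow> closure (cspan (\<Union>\<S>)) \<in> \<N>)"

definition bounded_clinear :: "('a::chilbert_space \<Rightarrow> 'b::chilbert_space) \<Rightarrow> bool" where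
  "bounded_clinear T \<longleftrightarrow> bounded_linear T \<and> (\<forall>c x. T (c *\<^sub>C x) = c *\<^sub>C T x)"

definition nest_algebra :: "'a::chilbert_space set set \<Rightarrow> ('a \<Rightarrow> 'a) set" where
  "nest_algebra \<N> = {T. bounded_clinear T \<and> (\<forall>N\<in>\<N>. T ` N \<subseteq> N)}"

definition distr_freq :: "('a::metric_space \<Rightarrow> 'a) \<Rightarrow> nat \<Rightarrow> 'a \<Rightarrow> 'a \<Rightarrow> real \<Rightarrow> real" where
  "distr_freq f n x y \<tau> = real (card {i. i < n \<and> dist ((f ^^ i) x) ((f ^^ i) y) < \<tau>}) / real n"

text \<open>
  The frequencies lie in \<open>[0, 1]\<close>; they are embedded into \<open>ereal\<close> only because \<open>liminf\<close> and
  \<open>limsup\<close> need a complete lattice.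
\<close>

definition lower_distr :: "('a::metric_space \<Rightarrow> 'a) \<Rightarrow> 'a \<Rightarrow> 'a \<Rightarrow> real \<Rightarrow> ereal" where
  "lower_distr f x y \<tau> = liminf (\<lambda>n. ereal (distr_freq f n x y \<tau>))"

definition upper_distr :: "('a::metric_space \<Rightarrow> 'a) \<Rightarrow> 'a \<Rightarrow> 'a \<Rightarrow> real \<Rightarrow> ereal" where
  "upper_distr f x y \<tau> = limsup (\<lambda>n. ereal (distr_freq f n x y \<tau>))"

definition distr_chaotic_pair :: "('a::metric_space \<Rightarrow> 'a) \<Rightarrow> 'a \<Rightarrow> 'a \<Rightarrow> bool" where
  "distr_chaotic_pair f x y \<longleftrightarrow>
     (\<forall>\<tau>>0. upper_distr f x y \<tau> = 1) \<and> (\<exists>\<epsilon>>0. lower_distr f x y \<epsilon> = 0)"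

definition distributionally_chaotic :: "('a::metric_space \<Rightarrow> 'a) \<Rightarrow> bool" where
  "distributionally_chaotic f \<longleftrightarrow>
     continuous_on UNIV f \<and>
     (\<exists>\<Lambda>. uncountable \<Lambda> \<and> (\<forall>x\<in>\<Lambda>. \<forall>y\<in>\<Lambda>. x \<noteq> y \<longrightarrow> distr_chaotic_pair f x y))"

end

theory Submission
  imports Defs
begin

text \<open>
  If a bounded operator has an orbit with \<open>\<parallel>T\<^sup>n x\<parallel>\<^sup>2 = u n\<close>, where \<open>u\<close> is close to \<open>0\<close> during very
  long blocks of time and at least \<open>1\<close> during other very long blocks, then the real line through
  \<open>x\<close> is distributionally scrambled.  Any positive \<open>u\<close> with \<open>u (n + 1) \<le> 2 * u n\<close> occurs in this
  way, both for a weighted forward shift and for twice the backward shift of an orthonormal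
  sequence \<open>e\<close>.  One of the two shifts can be placed in the nest algebra.  An infinite descending
  chain of the nest gives unit vectors \<open>e i\<close> in its gaps for which the forward shift leaves the
  nest invariant.  Otherwise the nest is well-ordered and has a least infinite-dimensional member
  \<open>M\<close>.  Below \<open>M\<close> there is either an infinite ascending chain of the nest or a largest member,
  with an infinite-dimensional gap up to \<open>M\<close>; in both cases the backward shift works.
\<close>

section \<open>Complex inner products\<close>

instance chilbert_space \<subseteq> banach ..

lemma cinner_add_right: "cinner x (y + z) = cinner x y + cinner x z"
  by (metis cinner_add_left cinner_commute complex_cnj_add)

lemma cinner_scaleC_right: "cinner x (a *\<^sub>C y) = cnj a * cinner x y"
  by (metis cinner_commute cinner_scaleC_left complex_cnj_mult)

lemma cinner_zero_left [simp]: "cinner 0 y = 0"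
  using cinner_add_left[of 0 0 y] by simp

lemma cinner_zero_right [simp]: "cinner x 0 = 0"
  using cinner_add_right[of x 0 0] by simp

lemma cinner_minus_left: "cinner (- x) y = - cinner x y"
  using cinner_add_left[of "- x" x y] by (simp add: add_eq_0_iff)

lemma cinner_diff_left: "cinner (x - y) z = cinner x z - cinner y z"
  using cinner_add_left[of x "- y" z] by (simp add: cinner_minus_left)

lemma cinner_sum_left: "cinner (sum f A) y = (\<Sum>i\<in>A. cinner (f i) y)"
  by (induction A rule: infinite_finite_induct) (auto simp: cinner_add_left)

lemma cinner_self: "cinner x x = complex_of_real ((norm x)\<^sup>2)"
proof (rule complex_eqI)
  show "Re (cinner x x) = Re (complex_of_real ((norm x)\<^sup>2))"
    by (simp add: Re_cinner power2_norm_eq_inner)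
  have "Im (cinner x x) = - Im (cinner x x)"
    by (metis cinner_commute cnj.simps(2))
  then show "Im (cinner x x) = Im (complex_of_real ((norm x)\<^sup>2))" by simp
qed

text \<open>The class ties the norm only to the real inner product, so complex homogeneity is read
  off from \<open>cinner\<close> through squared norms.\<close>

lemma norm_scaleC: "norm (c *\<^sub>C x) = cmod c * norm x"
proof -
  have "complex_of_real ((norm (c *\<^sub>C x))\<^sup>2) = c * cnj c * complex_of_real ((norm x)\<^sup>2)"
    unfolding cinner_self [symmetric] by (simp add: cinner_scaleC_left cinner_scaleC_right)
  also have "\<dots> = complex_of_real ((cmod c * norm x)\<^sup>2)"
    by (simp add: complex_norm_square [symmetric] power_mult_distrib)
  finally have "(norm (c *\<^sub>C x))\<^sup>2 = (cmod c * norm x)\<^sup>2"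
    using of_real_eq_iff by blast
  then show ?thesis by (simp add: power2_eq_iff_nonneg)
qed

lemma scaleC_scaleR: "c *\<^sub>C (r *\<^sub>R x) = r *\<^sub>R (c *\<^sub>C x)"
  by (simp add: scaleC_of_real [symmetric] scaleC_scaleC mult.commute)

lemma cinner_scaleR_left: "cinner (r *\<^sub>R x) y = r *\<^sub>R cinner x y"
  by (metis scaleC_of_real cinner_scaleC_left scaleR_conv_of_real)

lemma bounded_linear_scaleC: "bounded_linear (\<lambda>x. c *\<^sub>C x)"
  by (rule bounded_linear_intro[where K = "cmod c"])
    (auto simp: scaleC_add_right scaleC_scaleR norm_scaleC mult.commute)

lemma bounded_linear_scaleC_left: "bounded_linear (\<lambda>c. c *\<^sub>C x)"
  by (rule bounded_linear_intro[where K = "norm x"])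
    (auto simp: scaleC_add_left norm_scaleC scaleR_conv_of_real scaleC_of_real [symmetric]
      scaleC_scaleC)

text \<open>Real Cauchy-Schwarz bounds the real part and, with \<open>(- \<i>) *\<^sub>C x\<close>
  in place of \<open>x\<close>, the imaginary part. Adding both bounds costs the factor 2, which is
  harmless where only continuity of \<open>cinner\<close> is at stake.\<close>

lemma cmod_cinner_le: "cmod (cinner x y) \<le> 2 * (norm x * norm y)"
proof -
  have "Im (cinner x y) = Re (cinner ((- \<i>) *\<^sub>C x) y)"
    unfolding cinner_scaleC_left by simp
  then have "\<bar>Im (cinner x y)\<bar> \<le> norm ((- \<i>) *\<^sub>C x) * norm y"
    unfolding Re_cinner by (metis Cauchy_Schwarz_ineq2)
  moreover have "\<bar>Re (cinner x y)\<bar> \<le> norm x * norm y"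
    by (simp add: Re_cinner Cauchy_Schwarz_ineq2)
  ultimately show ?thesis
    using cmod_le[of "cinner x y"] by (simp add: norm_scaleC)
qed

lemma bounded_linear_cinner_left: "bounded_linear (\<lambda>x. cinner x y)"
  by (rule bounded_linear_intro[where K = "2 * norm y"])
    (use cmod_cinner_le in \<open>auto simp: cinner_add_left cinner_scaleR_left mult_ac\<close>)

lemma csubspace_scaleR: "csubspace L \<Longrightarrow> x \<in> L \<Longrightarrow> r *\<^sub>R x \<in> L"
  by (metis complex_vector.subspace_scale scaleC_of_real)

text \<open>The subspace also contains \<open>\<i> *\<^sub>C z\<close>, and the real inner product
  of \<open>x\<close> with that vector is the imaginary part of \<open>cinner x z\<close>.\<close>

lemma complex_orthogonal_if_real_orthogonal:
  assumes "csubspace L" and "\<And>z. z \<in> L \<Longrightarrow> inner x z = 0" and "z \<in> L"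
  shows "cinner x z = 0"
proof (rule complex_eqI)
  have "\<i> *\<^sub>C z \<in> L" by (rule complex_vector.subspace_scale) fact+
  then have "Re (cinner x (\<i> *\<^sub>C z)) = 0" by (simp add: Re_cinner assms(2))
  then show "Im (cinner x z) = Im 0" by (simp add: cinner_scaleC_right)
qed (simp add: Re_cinner assms)

section \<open>Orthogonal projection\<close>

text \<open>A sequence in \<open>L\<close> minimizing the distance to \<open>x\<close> is Cauchy by
  the parallelogram law. Its limit is a nearest point, and minimality along every real line through
  it forces orthogonality.\<close>

lemma orthogonal_projection_exists:
  fixes L :: "'a::chilbert_space set"
  assumes L: "csubspace L" and "closed L"
  obtains p where "p \<in> L" "\<And>z. z \<in> L \<Longrightarrow> cinner (x - p) z = 0"
proof -
  have "L \<noteq> {}" using complex_vector.subspace_0[OF L] by auto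
  define d where "d = infdist x L"
  have d_le: "d \<le> norm (x - z)" if "z \<in> L" for z
    using infdist_le[OF that, of x] by (simp add: d_def dist_norm)
  have "d \<ge> 0" by (simp add: d_def infdist_nonneg)
  have "\<exists>z\<in>L. norm (x - z) < d + 1 / real (Suc n)" for n
  proof -
    have "(INF a\<in>L. dist x a) < d + 1 / real (Suc n)"
      using \<open>L \<noteq> {}\<close> by (simp add: d_def infdist_notempty)
    then show ?thesis
      by (subst (asm) cINF_less_iff) (use \<open>L \<noteq> {}\<close> in \<open>auto simp flip: dist_norm\<close>)
  qed
  then obtain z where zL: "\<And>n. z n \<in> L"
    and z_less: "\<And>n. norm (x - z n) < d + 1 / real (Suc n)" by metis
  have z_lim: "(\<lambda>n. norm (x - z n)) \<longlonglongrightarrow> d"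
  proof (rule tendsto_sandwich[OF _ _ tendsto_const])
    show "(\<lambda>n. d + 1 / real (Suc n)) \<longlonglongrightarrow> d"
      using tendsto_add[OF tendsto_const[of d] LIMSEQ_inverse_real_of_nat]
      by (simp add: inverse_eq_divide)
    show "\<forall>\<^sub>F n in sequentially. norm (x - z n) \<le> d + 1 / real (Suc n)"
      by (intro always_eventually allI less_imp_le z_less)
  qed (use d_le zL in auto)
  \<comment> \<open>The parallelogram law applied to \<open>x - z m\<close> and \<open>x - z n\<close>, whose sum has norm at least \<open>2 * d\<close>.\<close>
  have para: "(norm (z m - z n))\<^sup>2 \<le> 2 * (norm (x - z m))\<^sup>2 + 2 * (norm (x - z n))\<^sup>2 - 4 * d\<^sup>2" for m n
  proof -
    have "(1/2) *\<^sub>R (z m + z n) \<in> L"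
      by (simp add: L zL csubspace_scaleR complex_vector.subspace_add)
    then have "d\<^sup>2 \<le> (norm (x - (1/2) *\<^sub>R (z m + z n)))\<^sup>2"
      using d_le \<open>d \<ge> 0\<close> by (simp add: power_mono)
    moreover have "(norm (z m - z n))\<^sup>2 + 4 * (norm (x - (1/2) *\<^sub>R (z m + z n)))\<^sup>2 =
        2 * (norm (x - z m))\<^sup>2 + 2 * (norm (x - z n))\<^sup>2"
      by (simp add: power2_norm_eq_inner inner_diff_left inner_diff_right inner_add_left
          inner_add_right inner_commute algebra_simps)
    ultimately show ?thesis by linarith
  qed
  have "Cauchy z"
  proof (rule metric_CauchyI)
    fix e :: real assume "e > 0"
    have "(\<lambda>n. (norm (x - z n))\<^sup>2) \<longlonglongrightarrow> d\<^sup>2" by (intro tendsto_intros z_lim)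
    \<comment> \<open>Both squared distances enter \<open>para\<close> with factor 2, so an excess
      below \<open>e\<^sup>2 / 4\<close> in each keeps the bound below
      \<open>e\<^sup>2\<close>.\<close>
    then have "\<forall>\<^sub>F n in sequentially. (norm (x - z n))\<^sup>2 < d\<^sup>2 + e\<^sup>2 / 4"
      by (rule order_tendstoD) (use \<open>e > 0\<close> in simp)
    then obtain K where K: "\<And>n. n \<ge> K \<Longrightarrow> (norm (x - z n))\<^sup>2 < d\<^sup>2 + e\<^sup>2 / 4"
      by (auto simp: eventually_sequentially)
    have "dist (z m) (z n) < e" if "m \<ge> K" "n \<ge> K" for m n
    proof -
      have "(norm (z m - z n))\<^sup>2 < e\<^sup>2" using para[of m n] K[OF that(1)] K[OF that(2)] by simp
      then show ?thesis using \<open>e > 0\<close> by (simp add: dist_norm power_less_imp_less_base)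
    qed
    then show "\<exists>M. \<forall>m\<ge>M. \<forall>n\<ge>M. dist (z m) (z n) < e" by blast
  qed
  then obtain p where p: "z \<longlonglongrightarrow> p" using Cauchy_convergent convergent_def by blast
  have "p \<in> L" using closed_sequentially[OF \<open>closed L\<close> zL p] .
  have "(\<lambda>n. norm (x - z n)) \<longlonglongrightarrow> norm (x - p)" by (intro tendsto_intros p)
  then have norm_p: "norm (x - p) = d" using z_lim LIMSEQ_unique by blast
  have "inner (x - p) y = 0" if "y \<in> L" for y
  proof (rule ccontr)
    assume nz: "inner (x - p) y \<noteq> 0"
    define c where "c = inner (x - p) y"
    have "y \<noteq> 0" using nz by auto
    then have ny: "(norm y)\<^sup>2 > 0" by simp
    \<comment> \<open>This \<open>s\<close> minimizes the squared distance from \<open>x\<close>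
      along the line \<open>p + s *\<^sub>R y\<close>; the minimum is smaller than
      \<open>d\<^sup>2\<close> by \<open>c\<^sup>2 / (norm y)\<^sup>2\<close>.\<close>
    define s where "s = c / (norm y)\<^sup>2"
    have "p + s *\<^sub>R y \<in> L"
      by (simp add: L \<open>p \<in> L\<close> that csubspace_scaleR complex_vector.subspace_add)
    then have "d\<^sup>2 \<le> (norm (x - (p + s *\<^sub>R y)))\<^sup>2" using d_le \<open>d \<ge> 0\<close> by (simp add: power_mono)
    also have "\<dots> = (norm (x - p))\<^sup>2 - 2 * s * c + s\<^sup>2 * (norm y)\<^sup>2"
      by (simp add: c_def power2_norm_eq_inner inner_diff_left inner_diff_right inner_add_left
          inner_add_right inner_commute algebra_simps power2_eq_square[of s])
    also have "\<dots> = d\<^sup>2 - c\<^sup>2 / (norm y)\<^sup>2"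
      using ny by (simp add: norm_p s_def power2_eq_square field_simps)
    finally show False using ny nz by (simp add: c_def divide_le_0_iff)
  qed
  then have "cinner (x - p) y = 0" if "y \<in> L" for y
    using complex_orthogonal_if_real_orthogonal[OF L _ that] by blast
  with \<open>p \<in> L\<close> show thesis by (rule that)
qed

section \<open>Orthonormal sequences\<close>

definition corthonormal :: "(nat \<Rightarrow> 'a::chilbert_space) \<Rightarrow> bool" where
  "corthonormal e \<longleftrightarrow> (\<forall>i j. cinner (e i) (e j) = (if i = j then 1 else 0))"

lemma corthonormal_norm: "corthonormal e \<Longrightarrow> norm (e i) = 1"
proof -
  assume "corthonormal e"
  then have "cinner (e i) (e i) = 1" by (simp add: corthonormal_def)
  then have "complex_of_real ((norm (e i))\<^sup>2) = of_real 1" unfolding cinner_self by simp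
  then have "(norm (e i))\<^sup>2 = 1" by (simp only: of_real_eq_iff)
  then show ?thesis by (simp add: power2_eq_1_iff) (smt (verit) norm_ge_zero)
qed

lemma cinner_sum_corthonormal:
  assumes "corthonormal e" "finite A"
  shows "cinner (\<Sum>i\<in>A. a i *\<^sub>C e i) (e j) = (if j \<in> A then a j else 0)"
proof -
  have "cinner (\<Sum>i\<in>A. a i *\<^sub>C e i) (e j) = (\<Sum>i\<in>A. if i = j then a i else 0)"
    unfolding cinner_sum_left
    by (rule sum.cong) (use assms in \<open>auto simp: cinner_scaleC_left corthonormal_def\<close>)
  then show ?thesis using assms by simp
qed

lemma norm_sum_corthonormal:
  assumes "corthonormal e" "finite A"
  shows "(norm (\<Sum>i\<in>A. a i *\<^sub>C e i))\<^sup>2 = (\<Sum>i\<in>A. (cmod (a i))\<^sup>2)"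
  using assms(2)
proof (induction A)
  case (insert j A)
  let ?s = "\<Sum>i\<in>A. a i *\<^sub>C e i"
  have "cinner ?s (a j *\<^sub>C e j) = 0"
    using insert assms(1) by (simp add: cinner_scaleC_right cinner_sum_corthonormal)
  then have "inner ?s (a j *\<^sub>C e j) = 0" by (metis Re_cinner zero_complex.sel(1))
  then have "(norm (a j *\<^sub>C e j + ?s))\<^sup>2 = (norm (a j *\<^sub>C e j))\<^sup>2 + (norm ?s)\<^sup>2"
    by (simp add: power2_norm_eq_inner inner_add_left inner_add_right inner_commute)
  then show ?case
    using insert assms(1) by (simp add: norm_scaleC corthonormal_norm)
qed simp

text \<open>Each partial Fourier sum is orthogonal to its remainder, so Pythagoras bounds all
  partial sums of the squares uniformly.\<close>

lemma bessel_inequality: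
  assumes e: "corthonormal e"
  shows "summable (\<lambda>i. (cmod (cinner x (e i)))\<^sup>2)" "(\<Sum>i. (cmod (cinner x (e i)))\<^sup>2) \<le> (norm x)\<^sup>2"
proof -
  have *: "(\<Sum>i<n. (cmod (cinner x (e i)))\<^sup>2) \<le> (norm x)\<^sup>2" for n
  proof -
    let ?s = "\<Sum>i<n. cinner x (e i) *\<^sub>C e i"
    have "cinner (x - ?s) (e i) = 0" if "i < n" for i
      unfolding cinner_diff_left cinner_sum_corthonormal[OF e finite_lessThan] using that by simp
    then have "cinner ?s (x - ?s) = 0"
      by (subst cinner_sum_left, subst cinner_scaleC_left, subst cinner_commute) simp
    then have "inner ?s (x - ?s) = 0" by (metis Re_cinner zero_complex.sel(1))
    then have "(norm (?s + (x - ?s)))\<^sup>2 = (norm ?s)\<^sup>2 + (norm (x - ?s))\<^sup>2"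
      unfolding power2_norm_eq_inner inner_add_left inner_add_right by (simp add: inner_commute)
    then show ?thesis using norm_sum_corthonormal[OF e, of "{..<n}" "\<lambda>i. cinner x (e i)"] by simp
  qed
  show s: "summable (\<lambda>i. (cmod (cinner x (e i)))\<^sup>2)"
    by (rule summableI_nonneg_bounded[OF _ *]) simp
  show "(\<Sum>i. (cmod (cinner x (e i)))\<^sup>2) \<le> (norm x)\<^sup>2"
    by (rule suminf_le_const[OF s *])
qed

text \<open>Riesz-Fischer: Pythagoras turns blocks of the vector series into blocks of the square
  sum, and completeness gives convergence. Norm and coordinates follow by continuity.\<close>

lemma summable_corthonormal:
  fixes e :: "nat \<Rightarrow> 'a::chilbert_space"
  assumes e: "corthonormal e" and a: "summable (\<lambda>i. (cmod (a i))\<^sup>2)"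
  shows "summable (\<lambda>i. a i *\<^sub>C e i)"
    and "(norm (\<Sum>i. a i *\<^sub>C e i))\<^sup>2 = (\<Sum>i. (cmod (a i))\<^sup>2)"
    and "cinner (\<Sum>i. a i *\<^sub>C e i) (e j) = a j"
proof -
  show s: "summable (\<lambda>i. a i *\<^sub>C e i)"
    unfolding summable_Cauchy
  proof (intro allI impI)
    fix r :: real assume "r > 0"
    then obtain N where N: "\<And>m n. m \<ge> N \<Longrightarrow> norm (\<Sum>i=m..<n. (cmod (a i))\<^sup>2) < r\<^sup>2"
      using a unfolding summable_Cauchy by (meson zero_less_power)
    have "norm (\<Sum>i=m..<n. a i *\<^sub>C e i) < r" if "m \<ge> N" for m n
    proof -
      have "(norm (\<Sum>i=m..<n. a i *\<^sub>C e i))\<^sup>2 < r\<^sup>2"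
        using N[OF that, of n] by (simp add: norm_sum_corthonormal[OF e] sum_nonneg)
      then show ?thesis using \<open>r > 0\<close> by (simp add: power_less_imp_less_base)
    qed
    then show "\<exists>N. \<forall>m\<ge>N. \<forall>n. norm (\<Sum>i=m..<n. a i *\<^sub>C e i) < r" by blast
  qed
  have "(\<lambda>n. (norm (\<Sum>i<n. a i *\<^sub>C e i))\<^sup>2) \<longlonglongrightarrow> (norm (\<Sum>i. a i *\<^sub>C e i))\<^sup>2"
    by (intro tendsto_intros summable_LIMSEQ s)
  moreover have "(\<lambda>n. (norm (\<Sum>i<n. a i *\<^sub>C e i))\<^sup>2) \<longlonglongrightarrow> (\<Sum>i. (cmod (a i))\<^sup>2)"
    using summable_LIMSEQ[OF a] by (simp add: norm_sum_corthonormal[OF e])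
  ultimately show "(norm (\<Sum>i. a i *\<^sub>C e i))\<^sup>2 = (\<Sum>i. (cmod (a i))\<^sup>2)"
    using LIMSEQ_unique by blast
  have "cinner (\<Sum>i. a i *\<^sub>C e i) (e j) = (\<Sum>i. cinner (a i *\<^sub>C e i) (e j))"
    by (rule bounded_linear.suminf[OF bounded_linear_cinner_left s])
  also have "\<dots> = (\<Sum>i. if i = j then a i else 0)"
    using e by (intro suminf_cong) (simp add: cinner_scaleC_left corthonormal_def)
  also have "\<dots> = a j" using sums_single[of j a] sums_unique by fastforce
  finally show "cinner (\<Sum>i. a i *\<^sub>C e i) (e j) = a j" .
qed

text \<open>Covers both shifts: one of \<open>e\<close>, \<open>f\<close> will be the other sequence
  moved by one index. Bessel for \<open>f\<close> yields the norm bound \<open>B\<close>. On a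
  member \<open>M\<close> of the nest every term of the series lies in \<open>M\<close>, because
  either its vector does or its coefficient vanishes, and \<open>M\<close> is closed.\<close>

lemma corthonormal_operator:
  fixes e f :: "nat \<Rightarrow> 'a::chilbert_space" and w :: "nat \<Rightarrow> real"
  assumes e: "corthonormal e" and f: "corthonormal f" and w: "\<And>i. \<bar>w i\<bar> \<le> B"
    and N: "nest \<N>" "\<And>M i. M \<in> \<N> \<Longrightarrow> e i \<in> M \<or> (\<forall>x\<in>M. cinner x (f i) = 0)"
  shows "(\<lambda>x. \<Sum>i. (w i * cinner x (f i)) *\<^sub>C e i) \<in> nest_algebra \<N>"
proof -
  define T where "T = (\<lambda>x. \<Sum>i. (w i * cinner x (f i)) *\<^sub>C e i)"
  have "B \<ge> 0" using w[of 0] by linarith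
  have le: "(cmod (w i * cinner x (f i)))\<^sup>2 \<le> B\<^sup>2 * (cmod (cinner x (f i)))\<^sup>2" for x i
    using w[of i] by (auto simp: norm_mult power_mult_distrib 
        intro!: mult_right_mono power2_le_iff_abs_le[THEN iffD2] \<open>B \<ge> 0\<close>)
  have sB: "summable (\<lambda>i. B\<^sup>2 * (cmod (cinner x (f i)))\<^sup>2)" for x
    by (intro summable_mult bessel_inequality f)
  have s2: "summable (\<lambda>i. (cmod (w i * cinner x (f i)))\<^sup>2)" for x
    by (rule summable_comparison_test'[OF sB]) (use le in simp)
  have s: "summable (\<lambda>i. (w i * cinner x (f i)) *\<^sub>C e i)" for x
    by (rule summable_corthonormal[OF e s2])
  have "T (x + y) = T x + T y" for x y
    unfolding T_def by (subst suminf_add[OF s s]) (simp add: cinner_add_left distrib_left scaleC_add_left)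
  moreover have "T (c *\<^sub>C x) = c *\<^sub>C T x" for c x
    unfolding T_def bounded_linear.suminf[OF bounded_linear_scaleC s]
    by (simp add: cinner_scaleC_left scaleC_scaleC mult_ac)
  moreover have "norm (T x) \<le> norm x * B" for x
  proof (rule power2_le_imp_le)
    have "(norm (T x))\<^sup>2 \<le> (\<Sum>i. B\<^sup>2 * (cmod (cinner x (f i)))\<^sup>2)"
      unfolding T_def summable_corthonormal(2)[OF e s2] by (rule suminf_le[OF le s2 sB])
    also have "\<dots> \<le> (norm x * B)\<^sup>2"
      using bessel_inequality[OF f, of x]
      by (simp add: suminf_mult power_mult_distrib mult.commute mult_left_mono)
    finally show "(norm (T x))\<^sup>2 \<le> (norm x * B)\<^sup>2" .
  qed (simp add: \<open>B \<ge> 0\<close>)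
  ultimately have "bounded_clinear T"
    unfolding bounded_clinear_def
    by (auto intro!: bounded_linear_intro[where K = B] simp: scaleC_of_real [symmetric])
  moreover have "T x \<in> M" if M: "M \<in> \<N>" and "x \<in> M" for M x
  proof -
    have sub: "csubspace M" and "closed M" using N(1) M by (auto simp: nest_def)
    have "(w i * cinner x (f i)) *\<^sub>C e i \<in> M" for i
      using N(2)[OF M, of i] \<open>x \<in> M\<close> sub
      by (auto simp: complex_vector.subspace_scale complex_vector.subspace_0)
    then have "(\<Sum>i<n. (w i * cinner x (f i)) *\<^sub>C e i) \<in> M" for n
      by (intro complex_vector.subspace_sum sub)
    then show ?thesis
      unfolding T_def by (rule closed_sequentially[OF \<open>closed M\<close> _ summable_LIMSEQ[OF s]])
  qed
  ultimately show ?thesis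
    unfolding nest_algebra_def T_def by blast
qed

section \<open>Orthonormal sequences adapted to a nest\<close>

lemma unit_vector_orthogonal_exists:
  fixes L M :: "'a::chilbert_space set"
  assumes L: "csubspace L" "closed L" and M: "csubspace M" and "L \<subset> M"
  shows "\<exists>e\<in>M. cinner e e = 1 \<and> (\<forall>z\<in>L. cinner e z = 0)"
proof -
  obtain x where x: "x \<in> M" "x \<notin> L" using \<open>L \<subset> M\<close> by blast
  obtain p where p: "p \<in> L" "\<And>z. z \<in> L \<Longrightarrow> cinner (x - p) z = 0"
    using orthogonal_projection_exists[OF L] by metis
  define e where "e = (1 / norm (x - p)) *\<^sub>R (x - p)"
  have "x - p \<noteq> 0" using x p by auto
  then have "norm e = 1" by (simp add: e_def)
  then have "cinner e e = 1" by (simp add: cinner_self)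
  moreover have "e \<in> M"
    using x p \<open>L \<subset> M\<close> by (auto simp: e_def intro!: csubspace_scaleR complex_vector.subspace_diff M)
  moreover have "\<forall>z\<in>L. cinner e z = 0" using p by (simp add: e_def cinner_scaleR_left)
  ultimately show ?thesis by blast
qed

text \<open>Take a unit vector of \<open>B i\<close> orthogonal to \<open>A i\<close>. For two
  different indices, \<open>sep\<close> places one of the two vectors in the space to which the
  other is orthogonal.\<close>

lemma corthonormal_between:
  fixes A B :: "nat \<Rightarrow> 'a::chilbert_space set"
  assumes A: "\<And>i. csubspace (A i)" "\<And>i. closed (A i)" and B: "\<And>i. csubspace (B i)"
    and AB: "\<And>i. A i \<subset> B i"
    and sep: "\<And>i j. i \<noteq> j \<Longrightarrow> B i \<subseteq> A j \<or> B j \<subseteq> A i"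
  obtains e where "corthonormal e" "\<And>i. e i \<in> B i" "\<And>i z. z \<in> A i \<Longrightarrow> cinner z (e i) = 0"
proof -
  obtain e where eB: "\<And>i. e i \<in> B i" and e1: "\<And>i. cinner (e i) (e i) = 1"
    and eA: "\<And>i z. z \<in> A i \<Longrightarrow> cinner (e i) z = 0"
    using unit_vector_orthogonal_exists[OF A B AB] by metis
  have eA': "cinner z (e i) = 0" if "z \<in> A i" for z i
    using eA[OF that] by (subst cinner_commute) simp
  have "cinner (e i) (e j) = 0" if "i \<noteq> j" for i j
    using sep[OF that] eB eA eA' by blast
  then have "corthonormal e" using e1 by (simp add: corthonormal_def)
  then show thesis using eB eA' that by blast
qed

lemma corthonormal_between_increasing:
  fixes G :: "nat \<Rightarrow> 'a::chilbert_space set"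
  assumes "\<And>i. csubspace (G i)" "\<And>i. closed (G i)" and G: "\<And>i. G i \<subset> G (Suc i)"
  obtains e where "corthonormal e" "\<And>i. e i \<in> G (Suc i)" "\<And>i z. z \<in> G i \<Longrightarrow> cinner z (e i) = 0"
proof (rule corthonormal_between[of G "\<lambda>i. G (Suc i)"])
  have "G i \<subseteq> G j" if "i \<le> j" for i j
    using lift_Suc_mono_le[of G i j] G that by blast
  then show "G (Suc i) \<subseteq> G j \<or> G (Suc j) \<subseteq> G i" if "i \<noteq> j" for i j
    using that by (metis Suc_leI linorder_neqE_nat)
qed (use assms that in auto)

text \<open>Here the gap with index \<open>i\<close> lies above \<open>G (Suc i)\<close>, so later
  vectors lie in smaller spaces; this reversal makes the forward shift the one compatible with the
  chain.\<close>

lemma corthonormal_between_decreasing: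
  fixes G :: "nat \<Rightarrow> 'a::chilbert_space set"
  assumes "\<And>i. csubspace (G i)" "\<And>i. closed (G i)" and G: "\<And>i. G (Suc i) \<subset> G i"
  obtains e where "corthonormal e" "\<And>i. e i \<in> G i" "\<And>i z. z \<in> G (Suc i) \<Longrightarrow> cinner z (e i) = 0"
proof (rule corthonormal_between[of "\<lambda>i. G (Suc i)" G])
  have "G j \<subseteq> G i" if "i \<le> j" for i j
    using lift_Suc_antimono_le[of G i j] G that by blast
  then show "G i \<subseteq> G (Suc j) \<or> G j \<subseteq> G (Suc i)" if "i \<noteq> j" for i j
    using that by (metis Suc_leI linorder_neqE_nat)
qed (use assms that in auto)

section \<open>Chains of closed subspaces and the choice of an adapted sequence\<close>

lemma closed_subspace_extend:
  fixes L M :: "'a::chilbert_space set"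
  assumes L: "csubspace L" "closed L" and M: "csubspace M" and "L \<subset> M"
  obtains e L' where "csubspace L'" "closed L'" "L \<subset> L'" "L' \<subseteq> M" "L' \<subseteq> cspan (insert e L)"
proof -
  obtain e where e: "e \<in> M" "cinner e e = 1" "\<And>z. z \<in> L \<Longrightarrow> cinner e z = 0"
    using unit_vector_orthogonal_exists[OF assms] by blast
  \<comment> \<open>This is the sum of \<open>L\<close> and the line through \<open>e\<close>;
    written as a preimage of \<open>L\<close> under a continuous map, it is visibly closed.\<close>
  define L' where "L' = (\<lambda>x. x - cinner x e *\<^sub>C e) -` L"
  have "csubspace L'"
    unfolding complex_vector.subspace_def L'_def
  proof (intro conjI ballI allI; simp)
    show "0 \<in> L" by (rule complex_vector.subspace_0[OF L(1)])
    fix x assume x: "x - cinner x e *\<^sub>C e \<in> L"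
    show "c *\<^sub>C x - cinner (c *\<^sub>C x) e *\<^sub>C e \<in> L" for c
      using complex_vector.subspace_scale[OF L(1) x, of c]
      by (simp add: cinner_scaleC_left complex_vector.scale_right_diff_distrib)
    show "x + y - cinner (x + y) e *\<^sub>C e \<in> L" if "y - cinner y e *\<^sub>C e \<in> L" for y
      using complex_vector.subspace_add[OF L(1) x that]
      by (simp add: cinner_add_left scaleC_add_left algebra_simps)
  qed
  moreover have "closed L'"
    unfolding L'_def
    using bounded_linear_compose[OF bounded_linear_scaleC_left bounded_linear_cinner_left]
    by (intro continuous_closed_vimage L continuous_intros linear_continuous_at)
  moreover have "cinner z e = 0" if "z \<in> L" for z
    using e(3)[OF that] by (subst cinner_commute) simp
  then have "L \<subseteq> L'" by (auto simp: L'_def)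
  moreover have "e \<in> L'" using e(2) complex_vector.subspace_0[OF L(1)] by (simp add: L'_def)
  moreover have "e \<notin> L" using e by fastforce
  moreover have "L' \<subseteq> M"
  proof
    fix x assume "x \<in> L'"
    then have "x - cinner x e *\<^sub>C e \<in> M" using \<open>L \<subset> M\<close> by (auto simp: L'_def)
    from complex_vector.subspace_add[OF M this complex_vector.subspace_scale[OF M e(1)]]
    show "x \<in> M" by (metis diff_add_cancel)
  qed
  moreover have "L' \<subseteq> cspan (insert e L)"
    by (auto simp: L'_def complex_vector.span_insert intro: complex_vector.span_base)
  ultimately show thesis using that by blast
qed

text \<open>The gap hypothesis says that \<open>M\<close> has infinite dimension modulo
  \<open>L\<close>. Adding one dimension at a time preserves this property, so the construction
  never stops.\<close>

lemma increasing_chain_in_infinite_gap: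
  fixes L M :: "'a::chilbert_space set"
  assumes L: "csubspace L" "closed L" "L \<subseteq> M" and M: "csubspace M"
    and inf: "\<And>F. finite F \<Longrightarrow> \<not> M \<subseteq> cspan (L \<union> F)"
  obtains G :: "nat \<Rightarrow> 'a set" where "\<And>i. csubspace (G i)" "\<And>i. closed (G i)"
    "\<And>i. G i \<subset> G (Suc i)" "\<And>i. L \<subseteq> G i" "\<And>i. G i \<subseteq> M"
proof -
  define P where "P = (\<lambda>G. csubspace G \<and> closed G \<and> L \<subseteq> G \<and> G \<subseteq> M \<and>
    (\<forall>F. finite F \<longrightarrow> \<not> M \<subseteq> cspan (G \<union> F)))"
  have "\<exists>G'. P G' \<and> G \<subset> G'" if "P G" for G
  proof -
    have G: "csubspace G" "closed G" "L \<subseteq> G" "G \<subseteq> M"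
      and Ginf: "\<And>F. finite F \<Longrightarrow> \<not> M \<subseteq> cspan (G \<union> F)"
      using that by (auto simp: P_def)
    have "G \<subset> M"
      using G Ginf[of "{}"] by (auto intro: complex_vector.span_base)
    then obtain e G' where G': "csubspace G'" "closed G'" "G \<subset> G'" "G' \<subseteq> M"
      "G' \<subseteq> cspan (insert e G)"
      using closed_subspace_extend[OF G(1,2) M] by metis
    have "\<not> M \<subseteq> cspan (G' \<union> F)" if "finite F" for F
    proof -
      \<comment> \<open>The new vector \<open>e\<close> is moved into the finite set, which reduces
        the claim for \<open>G'\<close> to the one for \<open>G\<close>.\<close>
      have "G' \<union> F \<subseteq> cspan (G \<union> insert e F)"
        using G'(5) complex_vector.span_mono[of "insert e G" "G \<union> insert e F"]
        by (auto intro: complex_vector.span_base)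
      then have "cspan (G' \<union> F) \<subseteq> cspan (G \<union> insert e F)"
        by (simp add: complex_vector.span_minimal)
      then show ?thesis using Ginf[of "insert e F"] that by auto
    qed
    then have "P G'" using G G' by (auto simp: P_def)
    then show ?thesis using G' by blast
  qed
  moreover have "P L" using assms by (auto simp: P_def)
  ultimately obtain G where "\<And>n. P (G n)" "\<And>n. G n \<subset> G (Suc n)"
    using dependent_nat_choice[of "\<lambda>_. P" "\<lambda>_ G G'. G \<subset> G'"] by metis
  then show thesis by (intro that[of G]) (simp_all add: P_def)
qed

text \<open>The two alternatives are the invariance condition of
  \<open>corthonormal_operator\<close> for the backward and for the forward shift.\<close>

lemma nest_adapted_sequence:
  fixes \<N> :: "'a::chilbert_space set set"
  assumes inf: "\<not> finite_cdim TYPE('a)" and N: "nest \<N>"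
  obtains (backward) e where "corthonormal e"
      "\<And>K i. K \<in> \<N> \<Longrightarrow> e i \<in> K \<or> (\<forall>x\<in>K. cinner x (e (Suc i)) = 0)"
  | (forward) e where "corthonormal e"
      "\<And>K i. K \<in> \<N> \<Longrightarrow> e (Suc i) \<in> K \<or> (\<forall>x\<in>K. cinner x (e i) = 0)"
proof -
  have sub: "csubspace M" and clo: "closed M" if "M \<in> \<N>" for M
    using that N by (auto simp: nest_def)
  have chain: "L \<subseteq> M \<or> M \<subseteq> L" if "L \<in> \<N>" "M \<in> \<N>" for L M
    using that N by (auto simp: nest_def)
  have zero: "{0} \<in> \<N>" and univ: "UNIV \<in> \<N>" using N by (auto simp: nest_def)
  have backward_chain: thesis
    if G: "\<And>i. G i \<in> \<N>" "\<And>i. G i \<subset> G (Suc i)" for G :: "nat \<Rightarrow> 'a set"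
  proof -
    obtain e where "corthonormal e" "\<And>i. e i \<in> G (Suc i)" "\<And>i z. z \<in> G i \<Longrightarrow> cinner z (e i) = 0"
      using corthonormal_between_increasing[of G] G sub clo by metis
    \<comment> \<open>Compare \<open>K\<close> with \<open>G (Suc i)\<close>: if \<open>K\<close> is
      the larger, it contains \<open>e i\<close>; otherwise it is orthogonal to
      \<open>e (Suc i)\<close>.\<close>
    then show thesis using backward[of e] chain G(1) by blast
  qed
  define r where "r = {(L, M). L \<in> \<N> \<and> M \<in> \<N> \<and> L \<subset> M}"
  show thesis
  proof (cases "wf r")
    case False
    then obtain G where "\<And>i. (G (Suc i), G i) \<in> r"
      unfolding wf_iff_no_infinite_down_chain by blast
    then have G: "G i \<in> \<N>" "G (Suc i) \<subset> G i" for i by (auto simp: r_def)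
    obtain e where "corthonormal e" "\<And>i. e i \<in> G i" "\<And>i z. z \<in> G (Suc i) \<Longrightarrow> cinner z (e i) = 0"
      using corthonormal_between_decreasing[of G] G sub clo by metis
    then show thesis using forward[of e] chain G(1) by blast
  next
    case True
    \<comment> \<open>Finite dimension of a subspace, expressed by a finite set whose span covers
      it. The aim is a least member \<open>M\<close> of the nest without this property; all members
      strictly below \<open>M\<close> then have it.\<close>
    define fd where "fd = (\<lambda>M::'a set. \<exists>F. finite F \<and> M \<subseteq> cspan F)"
    have "\<not> fd UNIV" using inf by (auto simp: fd_def finite_cdim_def)
    then have "UNIV \<in> {M \<in> \<N>. \<not> fd M}" using univ by simp
    with True obtain M where M: "M \<in> \<N>" "\<not> fd M"
      and min: "\<And>L. (L, M) \<in> r \<Longrightarrow> L \<notin> {M \<in> \<N>. \<not> fd M}"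
      by (rule wfE_min) blast
    have fd: "fd L" if "L \<in> \<N>" "L \<subset> M" for L
      using min[of L] that M by (auto simp: r_def)
    show thesis
    \<comment> \<open>The question is whether \<open>M\<close> has an immediate predecessor in the
      nest. If so, the predecessor has finite dimension and the gap above it is
      infinite-dimensional; if not, the members below \<open>M\<close> contain an ascending
      chain.\<close>
    proof (cases "\<exists>L\<in>\<N>. L \<subset> M \<and> (\<forall>K\<in>\<N>. K \<subset> M \<longrightarrow> K \<subseteq> L)")
      case True
      then obtain L where L: "L \<in> \<N>" "L \<subset> M" and L_max: "\<And>K. K \<in> \<N> \<Longrightarrow> K \<subset> M \<Longrightarrow> K \<subseteq> L"
        by meson
      have gap: "\<not> M \<subseteq> cspan (L \<union> F)" if "finite F" for F
      proof
        assume *: "M \<subseteq> cspan (L \<union> F)"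
        obtain E where E: "finite E" "L \<subseteq> cspan E" using fd[OF L] by (auto simp: fd_def)
        have "L \<union> F \<subseteq> cspan (E \<union> F)"
          using E(2) complex_vector.span_mono[of E "E \<union> F"]
          by (auto intro: complex_vector.span_base)
        then have "cspan (L \<union> F) \<subseteq> cspan (E \<union> F)"
          by (simp add: complex_vector.span_minimal)
        with * have "M \<subseteq> cspan (E \<union> F)" by blast
        with M(2) E(1) that show False by (auto simp: fd_def)
      qed
      obtain G :: "nat \<Rightarrow> 'a set" where G: "\<And>i. csubspace (G i)" "\<And>i. closed (G i)"
        "\<And>i. G i \<subset> G (Suc i)" "\<And>i. L \<subseteq> G i" "\<And>i. G i \<subseteq> M"
        using increasing_chain_in_infinite_gap[of L M] L M(1) sub clo gap by (metis psubsetE)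
      obtain e where e: "corthonormal e" "\<And>i. e i \<in> G (Suc i)"
        "\<And>i z. z \<in> G i \<Longrightarrow> cinner z (e i) = 0"
        using corthonormal_between_increasing[of G] G by metis
      show thesis
      proof (rule backward[OF e(1)])
        fix K i assume "K \<in> \<N>"
        \<comment> \<open>No member lies strictly between \<open>L\<close> and \<open>M\<close>.
          Members above \<open>M\<close> contain the whole sequence, and those inside
          \<open>L\<close> are orthogonal to it, so the positions of the \<open>G i\<close> relative
          to the nest do not matter.\<close>
        then have "M \<subseteq> K \<or> K \<subseteq> L" using chain M(1) L_max by blast
        then show "e i \<in> K \<or> (\<forall>x\<in>K. cinner x (e (Suc i)) = 0)"
          using e(2,3) G(4,5) by blast
      qed
    next
      case False
      have "{0} \<subset> M"
      proof -
        have "fd {0}" unfolding fd_def by (intro exI[of _ "{}"]) simp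
        then show ?thesis using M complex_vector.subspace_0[OF sub[OF M(1)]] by blast
      qed
      then have "\<exists>L. L \<in> \<N> \<and> L \<subset> M" using zero by (intro exI[of _ "{0}"] conjI)
      moreover have "\<exists>L'. (L' \<in> \<N> \<and> L' \<subset> M) \<and> L \<subset> L'" if L: "L \<in> \<N> \<and> L \<subset> M" for L
      proof -
        \<comment> \<open>As \<open>L\<close> is not the largest member below \<open>M\<close>, some
          \<open>K\<close> escapes it, and by comparability \<open>K\<close> is strictly
          larger.\<close>
        obtain K where K: "K \<in> \<N>" "K \<subset> M" "\<not> K \<subseteq> L" using False L by meson
        then have "L \<subset> K" using chain[of K L] L by auto
        with K show ?thesis by (intro exI[of _ K] conjI)
      qed
      ultimately have "\<exists>G. \<forall>n. (G n \<in> \<N> \<and> G n \<subset> M) \<and> G n \<subset> G (Suc n)"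
        by (rule dependent_nat_choice)
      then obtain G where "\<forall>n. (G n \<in> \<N> \<and> G n \<subset> M) \<and> G n \<subset> G (Suc n)" ..
      then show thesis by (intro backward_chain[of G]) simp_all
    qed
  qed
qed

section \<open>A slowly growing sequence with oscillating distribution\<close>

text \<open>
  The sequence is \<open>u n = (n + 1) / a k\<close> for \<open>b k \<le> n < b (k + 1)\<close>, where
  \<open>b k = 2 ^ (2 * k\<^sup>2)\<close> and \<open>a k = 2 ^ (2 * k\<^sup>2 + 2 * k)\<close> lies far from both ends of the block:
  \<open>u\<close> is small up to \<open>2 ^ (2 * k\<^sup>2 + k)\<close> and at least \<open>1\<close> from \<open>a k\<close> on.
\<close>

lemma oscillating_sequence_exists:
  obtains u :: "nat \<Rightarrow> real" where "\<And>n. u n > 0" "\<And>n. u (Suc n) \<le> 2 * u n"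
    "\<And>\<tau>. \<tau> > 0 \<Longrightarrow> limsup (\<lambda>n. ereal (real (card {i. i < n \<and> u i < \<tau>}) / real n)) = 1"
    "liminf (\<lambda>n. ereal (real (card {i. i < n \<and> u i < 1}) / real n)) = 0"
proof -
  define b :: "nat \<Rightarrow> nat" where "b k = 2 ^ (2 * k * k)" for k
  define a :: "nat \<Rightarrow> nat" where "a k = 2 ^ (2 * k * k + 2 * k)" for k
  \<comment> \<open>The index of the block containing \<open>n\<close>. Since
    \<open>b 0 = 1\<close>, time 0 precedes all blocks; the least-number definition assigns it to
    block 0.\<close>
  define \<kappa> where "\<kappa> n = (LEAST k. n < b (Suc k))" for n
  define u :: "nat \<Rightarrow> real" where "u n = (real n + 1) / real (a (\<kappa> n))" for n
  have b_mono: "b k \<le> b l" if "k \<le> l" for k l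
    using that by (auto simp: b_def intro!: power_increasing mult_le_mono)
  have "n < b (Suc n)" for n
  proof -
    have "n < 2 ^ n" by (rule less_exp)
    also have "\<dots> \<le> b (Suc n)" unfolding b_def by (rule power_increasing) auto
    finally show ?thesis .
  qed
  then have \<kappa>_less: "n < b (Suc (\<kappa> n))" for n unfolding \<kappa>_def by (rule LeastI)
  have \<kappa>_mono: "\<kappa> n \<le> \<kappa> (Suc n)" for n
    using \<kappa>_less[of "Suc n"] unfolding \<kappa>_def[of n] by (intro Least_le) simp
  have \<kappa>_eq: "\<kappa> i = k" if "b k \<le> i" "i < b (Suc k)" for i k
    unfolding \<kappa>_def
  proof (rule Least_equality)
    show "k \<le> y" if "i < b (Suc y)" for y
      using that \<open>b k \<le> i\<close> b_mono[of "Suc y" k] by (meson le_trans not_less not_less_eq_eq)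
  qed fact
  have a_pos: "a k > 0" for k by (simp add: a_def)
  have u_pos: "u n > 0" for n using a_pos[of "\<kappa> n"] by (simp add: u_def)
  have u_le: "u (Suc n) \<le> 2 * u n" for n
  proof -
    \<comment> \<open>The denominator never decreases, while the numerator grows from
      \<open>n + 1\<close> to \<open>n + 2\<close>, hence at most doubles.\<close>
    have "a (\<kappa> n) \<le> a (\<kappa> (Suc n))"
      using \<kappa>_mono[of n] by (auto simp: a_def intro!: power_increasing add_mono mult_le_mono)
    then have "u (Suc n) \<le> (2 * (real n + 1)) / real (a (\<kappa> n))"
      unfolding u_def using a_pos by (intro frac_le) auto
    then show ?thesis by (simp add: u_def)
  qed
  have freq_le: "real (card {i. i < n \<and> P i}) / real n \<le> 1" for n and P :: "nat \<Rightarrow> bool"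
  proof -
    have "card {i. i < n \<and> P i} \<le> card {..<n}" by (intro card_mono) auto
    then show ?thesis by (simp add: divide_le_eq)
  qed
  have lim: "(\<lambda>k. ereal ((1/2) ^ k)) \<longlonglongrightarrow> 0"
    using LIMSEQ_power_zero[of "1/2 :: real"] by (simp add: zero_ereal_def)
  have up: "limsup (\<lambda>n. ereal (real (card {i. i < n \<and> u i < \<tau>}) / real n)) = 1" if "\<tau> > 0" for \<tau>
  proof (rule antisym)
    let ?X = "\<lambda>n. ereal (real (card {i. i < n \<and> u i < \<tau>}) / real n)"
    show "limsup ?X \<le> 1" by (rule Limsup_bounded) (use freq_le in \<open>simp add: one_ereal_def\<close>)
    \<comment> \<open>Chosen so that \<open>b k / N k\<close> and \<open>N k / a k\<close> both
      equal \<open>(1/2) ^ k\<close>: the times before the block become negligible, and within the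
      block up to \<open>N k\<close> the values are still tiny.\<close>
    define N :: "nat \<Rightarrow> nat" where "N k = 2 ^ (2 * k * k + k)" for k
    have "strict_mono N"
      unfolding strict_mono_Suc_iff N_def by (intro allI power_strict_increasing) auto
    have "\<forall>\<^sub>F k in sequentially. (1/2) ^ k < \<tau>"
      by (rule order_tendstoD(2)[OF LIMSEQ_power_zero \<open>\<tau> > 0\<close>]) simp
    then have "\<forall>\<^sub>F k in sequentially. ereal (1 - (1/2) ^ k) \<le> (?X \<circ> N) k"
    proof eventually_elim
      case (elim k)
      have "{b k..<N k} \<subseteq> {i. i < N k \<and> u i < \<tau>}"
      proof safe
        fix i assume i: "i \<in> {b k..<N k}"
        have "N k \<le> b (Suc k)" unfolding N_def b_def by (rule power_increasing) auto
        then have "\<kappa> i = k" using i by (intro \<kappa>_eq) auto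
        then have "u i \<le> real (N k) / real (a k)"
          using i a_pos by (auto simp: u_def intro!: divide_right_mono)
        also have "\<dots> = (1/2) ^ k"
          by (simp add: N_def a_def power_add mult_2 power_one_over)
        finally show "u i < \<tau>" using elim by simp
      qed auto
      then have "card {b k..<N k} \<le> card {i. i < N k \<and> u i < \<tau>}"
        by (intro card_mono) auto
      then have "real (N k) - real (b k) \<le> real (card {i. i < N k \<and> u i < \<tau>})" by simp
      then have "(real (N k) - real (b k)) / real (N k) \<le>
          real (card {i. i < N k \<and> u i < \<tau>}) / real (N k)"
        by (rule divide_right_mono) simp
      moreover have "(real (N k) - real (b k)) / real (N k) = 1 - (1/2) ^ k"
        by (simp add: N_def b_def power_add power_one_over field_simps)
      ultimately show ?case by simp
    qed
    moreover have "(\<lambda>k. ereal (1 - (1/2) ^ k)) \<longlonglongrightarrow> 1"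
      using tendsto_diff[OF tendsto_const LIMSEQ_power_zero, of "1/2 :: real" 1]
      by (simp add: one_ereal_def)
    ultimately have "1 \<le> limsup (?X \<circ> N)"
      using Limsup_mono[of "\<lambda>k. ereal (1 - (1/2) ^ k)" "?X \<circ> N" sequentially]
        lim_imp_Limsup[of sequentially "\<lambda>k. ereal (1 - (1/2) ^ k)" 1] by simp
    also have "\<dots> \<le> limsup ?X" by (rule limsup_subseq_mono) fact
    finally show "1 \<le> limsup ?X" .
  qed
  have low: "liminf (\<lambda>n. ereal (real (card {i. i < n \<and> u i < 1}) / real n)) = 0"
  proof (rule antisym)
    let ?X = "\<lambda>n. ereal (real (card {i. i < n \<and> u i < 1}) / real n)"
    show "0 \<le> liminf ?X" by (rule Liminf_bounded) (simp add: zero_ereal_def)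
    \<comment> \<open>Sampling at the end of block \<open>k\<close>: values below 1 occur only
      before \<open>a k\<close>, a vanishing fraction of \<open>b (Suc k)\<close>.\<close>
    define N :: "nat \<Rightarrow> nat" where "N k = b (Suc k)" for k
    have "strict_mono N"
      unfolding strict_mono_Suc_iff N_def b_def by (intro allI power_strict_increasing) auto
    have "(?X \<circ> N) k \<le> ereal ((1/2) ^ k)" for k
    proof -
      have "{i. i < N k \<and> u i < 1} \<subseteq> {..<a k}"
      proof safe
        fix i assume i: "i < N k" "u i < 1"
        show "i < a k"
        proof (rule ccontr)
          assume "\<not> i < a k"
          moreover have "b k \<le> a k" unfolding b_def a_def by (rule power_increasing) auto
          ultimately have "\<kappa> i = k" using i by (intro \<kappa>_eq) (auto simp: N_def)
          then show False using i \<open>\<not> i < a k\<close> a_pos[of k] by (simp add: u_def divide_less_eq)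
        qed
      qed
      then have "card {i. i < N k \<and> u i < 1} \<le> card {..<a k}" by (rule card_mono[rotated]) simp
      then have "real (card {i. i < N k \<and> u i < 1}) / real (N k) \<le> real (a k) / real (N k)"
        by (intro divide_right_mono) auto
      also have "N k = a k * 2 ^ (2 * k + 2)"
        by (simp add: N_def b_def a_def algebra_simps flip: power_add)
      then have "real (a k) / real (N k) = (1/2) ^ (2 * k + 2)"
        using a_pos[of k] by (simp add: power_one_over)
      also have "\<dots> \<le> (1/2) ^ k" by (rule power_decreasing) auto
      finally show ?thesis by simp
    qed
    then have "liminf (?X \<circ> N) \<le> liminf (\<lambda>k. ereal ((1/2) ^ k))"
      by (intro Liminf_mono) simp
    also have "\<dots> = 0" by (rule lim_imp_Liminf[OF _ lim]) simp
    finally have "liminf (?X \<circ> N) \<le> 0" .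
    moreover have "liminf ?X \<le> liminf (?X \<circ> N)" by (rule liminf_subseq_mono) fact
    ultimately show "liminf ?X \<le> 0" by simp
  qed
  show thesis by (rule that[OF u_pos u_le up low])
qed

section \<open>Distributional chaos from a single orbit\<close>

text \<open>By linearity the orbits of \<open>s *\<^sub>R x\<close> and \<open>t *\<^sub>R x\<close>
  are at distance \<open>\<bar>s - t\<bar> * sqrt (u i)\<close> at time \<open>i\<close>, so every
  pair on the real line through \<open>x\<close> inherits the distribution of \<open>u\<close> with
  a rescaled threshold.\<close>

lemma distributionally_chaotic_if_orbit:
  fixes T :: "'a::chilbert_space \<Rightarrow> 'a" and u :: "nat \<Rightarrow> real"
  assumes T: "bounded_linear T" and orbit: "\<And>i. (norm ((T ^^ i) x))\<^sup>2 = u i"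
    and u_pos: "\<And>n. u n > 0"
    and up: "\<And>\<tau>. \<tau> > 0 \<Longrightarrow> limsup (\<lambda>n. ereal (real (card {i. i < n \<and> u i < \<tau>}) / real n)) = 1"
    and low: "liminf (\<lambda>n. ereal (real (card {i. i < n \<and> u i < 1}) / real n)) = 0"
  shows "distributionally_chaotic T"
proof -
  interpret T: bounded_linear T by fact
  have pow: "(T ^^ i) (s *\<^sub>R x) = s *\<^sub>R (T ^^ i) x" for i s
    by (induction i) (simp_all add: T.scaleR)
  have "x \<noteq> 0" using orbit[of 0] u_pos[of 0] by auto
  then have "inj (\<lambda>s::real. s *\<^sub>R x)" by (simp add: inj_on_def)
  then have "uncountable (range (\<lambda>s::real. s *\<^sub>R x))"
    using uncountable_UNIV_real countable_image_inj_on by blast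
  moreover have "distr_chaotic_pair T (s *\<^sub>R x) (t *\<^sub>R x)" if "s \<noteq> t" for s t
  proof -
    have freq: "distr_freq T n (s *\<^sub>R x) (t *\<^sub>R x) \<tau> =
        real (card {i. i < n \<and> u i < (\<tau> / \<bar>s - t\<bar>)\<^sup>2}) / real n" if "\<tau> > 0" for n \<tau>
    proof -
      have "dist ((T ^^ i) (s *\<^sub>R x)) ((T ^^ i) (t *\<^sub>R x)) < \<tau> \<longleftrightarrow> u i < (\<tau> / \<bar>s - t\<bar>)\<^sup>2" for i
      proof -
        have "dist ((T ^^ i) (s *\<^sub>R x)) ((T ^^ i) (t *\<^sub>R x)) = \<bar>s - t\<bar> * norm ((T ^^ i) x)"
          by (simp add: pow dist_norm flip: scaleR_left_diff_distrib)
        moreover have "\<bar>s - t\<bar> * norm ((T ^^ i) x) < \<tau> \<longleftrightarrow> norm ((T ^^ i) x) < \<tau> / \<bar>s - t\<bar>"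
          using \<open>s \<noteq> t\<close> by (simp add: pos_less_divide_eq mult.commute)
        moreover have "\<dots> \<longleftrightarrow> (norm ((T ^^ i) x))\<^sup>2 < (\<tau> / \<bar>s - t\<bar>)\<^sup>2"
          using \<open>\<tau> > 0\<close> by (simp add: abs_le_square_iff [symmetric] flip: not_le)
        ultimately show ?thesis by (simp add: orbit)
      qed
      then show ?thesis by (simp add: distr_freq_def)
    qed
    have "upper_distr T (s *\<^sub>R x) (t *\<^sub>R x) \<tau> = 1" if "\<tau> > 0" for \<tau>
      unfolding upper_distr_def freq[OF that] using that \<open>s \<noteq> t\<close> by (intro up) simp
    \<comment> \<open>With \<open>\<bar>s - t\<bar>\<close> as the distance bound, the rescaled
      threshold for \<open>u\<close> is exactly 1.\<close>
    moreover have "lower_distr T (s *\<^sub>R x) (t *\<^sub>R x) \<bar>s - t\<bar> = 0"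
      using low \<open>s \<noteq> t\<close> by (simp add: lower_distr_def freq)
    ultimately show ?thesis
      unfolding distr_chaotic_pair_def using \<open>s \<noteq> t\<close> by (metis zero_less_abs_iff right_minus_eq)
  qed
  ultimately show ?thesis
    unfolding distributionally_chaotic_def
    using T.continuous_on[OF continuous_on_id] by (intro conjI exI[of _ "range (\<lambda>s. s *\<^sub>R x)"]) auto
qed

section \<open>Shift orbits with prescribed norms\<close>

lemma forward_shift_orbit:
  fixes e :: "nat \<Rightarrow> 'a::chilbert_space" and u :: "nat \<Rightarrow> real"
  assumes e: "corthonormal e" and u_pos: "\<And>n. u n > 0"
  defines "T \<equiv> \<lambda>x. \<Sum>i. (complex_of_real (sqrt (u (Suc i) / u i)) * cinner x (e i)) *\<^sub>C e (Suc i)"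
  shows "(T ^^ n) (complex_of_real (sqrt (u 0)) *\<^sub>C e 0) = complex_of_real (sqrt (u n)) *\<^sub>C e n"
proof (induction n)
  case (Suc n)
  have "T (complex_of_real (sqrt (u n)) *\<^sub>C e n) =
      (\<Sum>i. if i = n then complex_of_real (sqrt (u (Suc i))) *\<^sub>C e (Suc i) else 0)"
    unfolding T_def
  proof (intro suminf_cong)
    fix i
    \<comment> \<open>The weight divides out the current norm and installs the next one, so the
      product of the weights telescopes.\<close>
    have "complex_of_real (sqrt (u (Suc n) / u n)) * complex_of_real (sqrt (u n)) =
        complex_of_real (sqrt (u (Suc n)))"
      using u_pos[of n] by (simp add: real_sqrt_divide)
    then show "(complex_of_real (sqrt (u (Suc i) / u i)) *
        cinner (complex_of_real (sqrt (u n)) *\<^sub>C e n) (e i)) *\<^sub>C e (Suc i) =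
        (if i = n then complex_of_real (sqrt (u (Suc i))) *\<^sub>C e (Suc i) else 0)"
      using e by (auto simp: cinner_scaleC_left corthonormal_def)
  qed
  also have "\<dots> = complex_of_real (sqrt (u (Suc n))) *\<^sub>C e (Suc n)"
    by (rule sums_unique[symmetric], rule sums_single)
  finally show ?case using Suc by simp
qed simp

text \<open>
  Twice the backward shift sends the vector with coordinates \<open>x j\<close> after \<open>n\<close> steps to a vector of
  squared norm \<open>4 ^ n * (\<Sum>j. (x (j + n))\<^sup>2)\<close>, so the tails of \<open>\<Sum>j. (x j)\<^sup>2\<close> have to be \<open>u n / 4 ^ n\<close>.
\<close>

lemma backward_shift_orbit:
  fixes e :: "nat \<Rightarrow> 'a::chilbert_space" and u :: "nat \<Rightarrow> real"
  assumes e: "corthonormal e" and u_pos: "\<And>n. u n > 0" and u_le: "\<And>n. u (Suc n) \<le> 2 * u n"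
  defines "T \<equiv> \<lambda>x. \<Sum>i. (complex_of_real 2 * cinner x (e (Suc i))) *\<^sub>C e i"
  obtains x where "\<And>n. (norm ((T ^^ n) x))\<^sup>2 = u n"
proof -
  define t where "t n = u n / 4 ^ n" for n
  \<comment> \<open>Coordinate \<open>j\<close> of the iterate with index \<open>n\<close>: the
    starting vector has coordinates whose squares are the differences of successive tails
    \<open>t\<close>.\<close>
  define c where "c n j = complex_of_real (2 ^ n * sqrt (t (j + n) - t (Suc (j + n))))" for n j
  have t_dec: "t (Suc n) \<le> t n" for n
    using u_le[of n] u_pos[of n] by (simp add: t_def field_simps)
  \<comment> \<open>Growth by at most 2 per step against division by 4 makes the tails decay
    geometrically, as telescoping to infinity requires.\<close>
  have "u n \<le> u 0 * 2 ^ n" for n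
  proof (induction n)
    case (Suc n)
    then show ?case using u_le[of n] by simp
  qed simp
  then have t_le: "t n \<le> u 0 * (1/2) ^ n" for n
    unfolding t_def using power_mult_distrib[of "2::real" 2 n]
    by (simp add: divide_le_eq power_one_over field_simps)
  have "t \<longlonglongrightarrow> 0"
  proof (rule tendsto_sandwich[OF _ _ tendsto_const])
    show "(\<lambda>n. u 0 * (1/2) ^ n) \<longlonglongrightarrow> 0"
      by (intro tendsto_mult_right_zero LIMSEQ_power_zero) simp
    show "\<forall>\<^sub>F n in sequentially. 0 \<le> t n"
      using u_pos by (simp add: t_def less_imp_le)
  qed (use t_le in auto)
  then have "(\<lambda>j. t (j + n)) \<longlonglongrightarrow> 0" for n by (rule LIMSEQ_ignore_initial_segment)
  from telescope_sums'[OF this] have "(\<lambda>j. 4 ^ n * (t (j + n) - t (Suc (j + n)))) sums (4 ^ n * t n)" for n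
    by (intro sums_mult) simp
  moreover have "(cmod (c n j))\<^sup>2 = 4 ^ n * (t (j + n) - t (Suc (j + n)))" for n j
    using t_dec[of "j + n"] power_mult_distrib[of "2::real" 2 n]
    by (simp add: c_def power_mult_distrib power2_eq_square del: of_real_mult of_real_power)
  ultimately have c: "(\<lambda>j. (cmod (c n j))\<^sup>2) sums u n" for n
    by (simp add: t_def)
  have "(T ^^ n) (\<Sum>j. c 0 j *\<^sub>C e j) = (\<Sum>j. c n j *\<^sub>C e j)" for n
  proof (induction n)
    case (Suc n)
    have "complex_of_real 2 * c n (Suc i) = c (Suc n) i" for i by (simp add: c_def)
    then have "T (\<Sum>j. c n j *\<^sub>C e j) = (\<Sum>j. c (Suc n) j *\<^sub>C e j)"
      unfolding T_def summable_corthonormal(3)[OF e sums_summable[OF c]] by simp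
    then show ?case using Suc by simp
  qed simp
  then have "(norm ((T ^^ n) (\<Sum>j. c 0 j *\<^sub>C e j)))\<^sup>2 = u n" for n
    using summable_corthonormal(2)[OF e sums_summable[OF c]] sums_unique[OF c] by simp
  then show thesis by (rule that)
qed

theorem proposition2p8:
  fixes \<N> :: "'a::chilbert_space set set"
  assumes "\<not> finite_cdim TYPE('a)"
    and "nest \<N>"
  shows "\<exists>T\<in>nest_algebra \<N>. distributionally_chaotic T"
proof -
  obtain u :: "nat \<Rightarrow> real" where u_pos: "\<And>n. u n > 0" and u_le: "\<And>n. u (Suc n) \<le> 2 * u n"
    and up: "\<And>\<tau>. \<tau> > 0 \<Longrightarrow> limsup (\<lambda>n. ereal (real (card {i. i < n \<and> u i < \<tau>}) / real n)) = 1"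
    and low: "liminf (\<lambda>n. ereal (real (card {i. i < n \<and> u i < 1}) / real n)) = 0"
    by (rule oscillating_sequence_exists) (rule that)
  have chaos: "distributionally_chaotic T"
    if "T \<in> nest_algebra \<N>" "\<And>i. (norm ((T ^^ i) x))\<^sup>2 = u i" for T x
    using distributionally_chaotic_if_orbit[OF _ that(2) u_pos up low] that(1)
    by (simp add: nest_algebra_def bounded_clinear_def)
  from assms show ?thesis
  proof (cases rule: nest_adapted_sequence)
    case (backward e)
    define T where "T = (\<lambda>x. \<Sum>i. (complex_of_real 2 * cinner x (e (Suc i))) *\<^sub>C e i)"
    have "corthonormal (\<lambda>i. e (Suc i))" using backward(1) by (simp add: corthonormal_def)
    then have "T \<in> nest_algebra \<N>"
      unfolding T_def using backward assms(2)
      by (intro corthonormal_operator[where w = "\<lambda>_. 2" and B = 2]) auto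
    moreover obtain x where "\<And>n. (norm ((T ^^ n) x))\<^sup>2 = u n"
      unfolding T_def using backward_shift_orbit[where e = e and u = u, OF backward(1) u_pos u_le] by blast
    ultimately show ?thesis using chaos by blast
  next
    case (forward e)
    define T where
      "T = (\<lambda>x. \<Sum>i. (complex_of_real (sqrt (u (Suc i) / u i)) * cinner x (e i)) *\<^sub>C e (Suc i))"
    have "corthonormal (\<lambda>i. e (Suc i))" using forward(1) by (simp add: corthonormal_def)
    \<comment> \<open>The growth condition on \<open>u\<close> is what bounds the weights, and hence
      the operator.\<close>
    moreover have "\<bar>sqrt (u (Suc i) / u i)\<bar> \<le> sqrt 2" for i
      using u_le[of i] u_pos by (simp add: divide_le_eq less_imp_le)
    ultimately have "T \<in> nest_algebra \<N>"
      unfolding T_def using forward assms(2) by (intro corthonormal_operator) auto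
    moreover have "(norm ((T ^^ n) (complex_of_real (sqrt (u 0)) *\<^sub>C e 0)))\<^sup>2 = u n" for n
      unfolding T_def forward_shift_orbit[where u = u, OF forward(1) u_pos]
      using u_pos[of n] by (simp add: norm_scaleC corthonormal_norm[OF forward(1)])
    ultimately show ?thesis using chaos by blast
  qed
qed

end
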